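(* Let $G$ be a compact Lie group, $\mathcal{B}$ a class of $G$-spaces, and let $R$ be the set of rest points of a gradient-like $G$-flow $\Phi=\{\varphi_t\}$ on a $G$-space $X$. Let $-\infty<a<b<\infty$, and let $f$ be a Lyapunov function for $\Phi$ such that there exists $\tau>0$ for which $(f,\varphi_\tau)$ satisfies condition (D) on $f^{-1}[a,b]$ and such that $\mathcal{B}_X f^a$ is finite. Then $$\sum_{d\in\,]a,b]}\mathcal{B}_X\bigl(R\cap f^{-1}(d)\bigr)\ \ge\ \mathcal{B}_X f^b-\mathcal{B}_X f^a .$$
   Context: All spaces are Hausdorff, all maps and functions are continuous. $f^a=\{x\in X\mid f(x)\le a\}$. A $G$-space is a space with a continuous $G$-action; a subspace of a $G$-space means a $G$-invariant subspace; a $G$-map is an equivariant map. A $G$-semiflow on $X$ is a family $\Phi=\{\varphi_t\}$, $t\ge0$, of $G$-maps $\varphi_t\colon X\to X$ with $\varphi_0=\mathrm{id}_X$, $\varphi_s\circ\varphi_t=\varphi_{s+t}$ for all $s,t\ge0$, and such that $X\times[0,\infty[\,\to X$, $(x,t)\mapsto\varphi_t(x)$, is continuous. It is a $G$-flow if each $\varphi_t$ is a homeomorphism. A rest point is a point $x$ with $\varphi_t(x)=x$ for all $t\ge0$. $\Phi$ is gradient-like if there is a $G$-invariant function $f\colon X\to\mathbb{R}$ such that $f(\varphi_t(x))<f(\varphi_s(x))$ whenever $t>s$ and $x$ is not a rest point of $\Phi$; any such $f$ is called a Lyapunov function for $\Phi$. Given a subset $A$ of $X$, $\mathcal{B}_X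 A$ is the minimal $k$ such that $A$ can be covered by $k$ open ($G$-invariant) subspaces $A_1,\dots,A_k$ of $X$ such that every $A_i$ is $G$-homeomorphic to a space from $\mathcal{B}$; it is $\infty$ if there is no such $k$. Conventions: $\infty\ge\infty$, $\infty\ge n$ and $\infty\ge\infty-n$ for all $n\in\mathbb{Z}$ (so $\infty-n$ is treated as $\infty$); a sum of values in $\{0,1,2,\dots,\infty\}$ is $\infty$ if some term is $\infty$ or infinitely many terms are nonzero. Condition (D): for $\varphi\colon X\to X$ and $Y\subset X$, $(f,\varphi)$ satisfies condition (D) on $Y$ if $f(\varphi(x))<f(x)$ whenever $x\in X$ is not a fixed point of $\varphi$, and: if $A\subset Y$ is a subset on which $|f|$ is bounded but on which $f(y)-f(\varphi(y))$ is not bounded away from zero, then there is a fixed point of $\varphi$ in the closure of $A$. *)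

theory Defs
  imports
    "HOL-Analysis.Analysis"
    "HOL-Algebra.Group_Action"
    "HOL-Library.Extended_Real"
begin

section \<open>Compact Lie groups\<close>

text \<open>Real functions of class C^k on an open subset U of \<^const>\<open>Euclidean_space\<close> n, by recursion
  on k: all partial derivatives exist on U and are of class C^(k-1). The dimension is a number, not
  a type, so that n = 0 (finite groups) is allowed.\<close>

primrec C_k_on :: "nat \<Rightarrow> nat \<Rightarrow> (nat \<Rightarrow> real) set \<Rightarrow> ((nat \<Rightarrow> real) \<Rightarrow> real) \<Rightarrow> bool" where
  "C_k_on 0 n U f \<longleftrightarrow> continuous_map (subtopology (Euclidean_space n) U) euclideanreal f"
| "C_k_on (Suc k) n U f \<longleftrightarrow>
     continuous_map (subtopology (Euclidean_space n) U) euclideanreal f \<and>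
     (\<forall>i<n. \<exists>D. (\<forall>x\<in>U. ((\<lambda>t. f (x(i := t))) has_real_derivative D x) (at (x i))) \<and>
                C_k_on k n U D)"

definition smooth_map_on ::
    "nat \<Rightarrow> nat \<Rightarrow> (nat \<Rightarrow> real) set \<Rightarrow> ((nat \<Rightarrow> real) \<Rightarrow> (nat \<Rightarrow> real)) \<Rightarrow> bool" where
  "smooth_map_on n m U F \<longleftrightarrow> (\<forall>j<m. \<forall>k. C_k_on k n U (\<lambda>x. F x j))"

text \<open>A chart is a pair (U, h) of an open set and a coordinate map on it; values of h outside U are
  irrelevant.\<close>

definition smooth_atlas :: "nat \<Rightarrow> 'g topology \<Rightarrow> ('g set \<times> ('g \<Rightarrow> nat \<Rightarrow> real)) set \<Rightarrow> bool" where
  "smooth_atlas n T \<A> \<longleftrightarrow>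
     (\<forall>(U, h)\<in>\<A>. openin T U \<and> openin (Euclidean_space n) (h ` U) \<and>
        homeomorphic_map (subtopology T U) (subtopology (Euclidean_space n) (h ` U)) h) \<and>
     (\<Union>(U, h)\<in>\<A>. U) = topspace T \<and>
     (\<forall>(U, h)\<in>\<A>. \<forall>(V, k)\<in>\<A>. smooth_map_on n n (h ` (U \<inter> V)) (\<lambda>x. k (inv_into U h x)))"

text \<open>The two projections of R^(2n) = R^n x R^n.\<close>

definition fst_coords :: "nat \<Rightarrow> (nat \<Rightarrow> real) \<Rightarrow> (nat \<Rightarrow> real)" where
  "fst_coords n z = (\<lambda>i. if i < n then z i else 0)"

definition snd_coords :: "nat \<Rightarrow> (nat \<Rightarrow> real) \<Rightarrow> (nat \<Rightarrow> real)" where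
  "snd_coords n z = (\<lambda>i. if i < n then z (n + i) else 0)"

definition smooth_mult ::
    "('g, 'm) monoid_scheme \<Rightarrow> nat \<Rightarrow> ('g set \<times> ('g \<Rightarrow> nat \<Rightarrow> real)) set \<Rightarrow> bool" where
  "smooth_mult G n \<A> \<longleftrightarrow>
     (\<forall>(U, h)\<in>\<A>. \<forall>(V, k)\<in>\<A>. \<forall>(W, l)\<in>\<A>.
        let m = (\<lambda>z. inv_into U h (fst_coords n z) \<otimes>\<^bsub>G\<^esub> inv_into V k (snd_coords n z)) in
        smooth_map_on (n + n) n
          {z \<in> topspace (Euclidean_space (n + n)).
             fst_coords n z \<in> h ` U \<and> snd_coords n z \<in> k ` V \<and> m z \<in> W}
          (\<lambda>z. l (m z)))"

definition smooth_inv ::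
    "('g, 'm) monoid_scheme \<Rightarrow> nat \<Rightarrow> ('g set \<times> ('g \<Rightarrow> nat \<Rightarrow> real)) set \<Rightarrow> bool" where
  "smooth_inv G n \<A> \<longleftrightarrow>
     (\<forall>(U, h)\<in>\<A>. \<forall>(V, k)\<in>\<A>.
        smooth_map_on n n {x \<in> h ` U. inv\<^bsub>G\<^esub> (inv_into U h x) \<in> V}
          (\<lambda>x. k (inv\<^bsub>G\<^esub> (inv_into U h x))))"

definition Lie_group :: "('g, 'm) monoid_scheme \<Rightarrow> 'g topology \<Rightarrow> bool" where
  "Lie_group G T \<longleftrightarrow>
     group G \<and> topspace T = carrier G \<and> Hausdorff_space T \<and> second_countable T \<and>
     continuous_map (prod_topology T T) T (\<lambda>(x, y). x \<otimes>\<^bsub>G\<^esub> y) \<and>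
     continuous_map T T (\<lambda>x. inv\<^bsub>G\<^esub> x) \<and>
     (\<exists>n \<A>. smooth_atlas n T \<A> \<and> smooth_mult G n \<A> \<and> smooth_inv G n \<A>)"

definition compact_Lie_group :: "('g, 'm) monoid_scheme \<Rightarrow> 'g topology \<Rightarrow> bool" where
  "compact_Lie_group G T \<longleftrightarrow> Lie_group G T \<and> compact_space T"


section \<open>G-spaces\<close>

definition G_space ::
    "('g, 'm) monoid_scheme \<Rightarrow> 'g topology \<Rightarrow> 'x topology \<Rightarrow> ('g \<Rightarrow> 'x \<Rightarrow> 'x) \<Rightarrow> bool" where
  "G_space G T X \<rho> \<longleftrightarrow>
     Hausdorff_space X \<and> group_action G (topspace X) \<rho> \<and>
     continuous_map (prod_topology T X) X (\<lambda>(g, x). \<rho> g x)"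

definition G_invariant ::
    "('g, 'm) monoid_scheme \<Rightarrow> ('g \<Rightarrow> 'x \<Rightarrow> 'x) \<Rightarrow> 'x set \<Rightarrow> bool" where
  "G_invariant G \<rho> A \<longleftrightarrow> (\<forall>g\<in>carrier G. \<forall>x\<in>A. \<rho> g x \<in> A)"

definition G_map ::
    "('g, 'm) monoid_scheme \<Rightarrow> 'x topology \<Rightarrow> ('g \<Rightarrow> 'x \<Rightarrow> 'x) \<Rightarrow>
     'y topology \<Rightarrow> ('g \<Rightarrow> 'y \<Rightarrow> 'y) \<Rightarrow> ('x \<Rightarrow> 'y) \<Rightarrow> bool" where
  "G_map G X \<rho> Y \<sigma> h \<longleftrightarrow>
     continuous_map X Y h \<and> (\<forall>g\<in>carrier G. \<forall>x\<in>topspace X. h (\<rho> g x) = \<sigma> g (h x))"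

definition G_homeomorphic ::
    "('g, 'm) monoid_scheme \<Rightarrow> 'x topology \<Rightarrow> ('g \<Rightarrow> 'x \<Rightarrow> 'x) \<Rightarrow>
     'y topology \<Rightarrow> ('g \<Rightarrow> 'y \<Rightarrow> 'y) \<Rightarrow> bool" where
  "G_homeomorphic G X \<rho> Y \<sigma> \<longleftrightarrow> (\<exists>h. homeomorphic_map X Y h \<and> G_map G X \<rho> Y \<sigma> h)"

text \<open>A class of G-spaces is a set of pairs (Y, \<open>\<sigma>\<close>) of a space and an action, over an
  arbitrary type \<open>'y\<close>. This loses nothing: only spaces G-homeomorphic to invariant subspaces of X
  matter, and \<open>'y\<close> may be chosen to contain copies of all of these. The infimum of the empty set of
  extended naturals is \<open>\<infinity>\<close>. The action on a subspace of X is given by the same function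
  \<open>\<rho>\<close>.\<close>

definition cover_number ::
    "('g, 'm) monoid_scheme \<Rightarrow> ('y topology \<times> ('g \<Rightarrow> 'y \<Rightarrow> 'y)) set \<Rightarrow>
     'x topology \<Rightarrow> ('g \<Rightarrow> 'x \<Rightarrow> 'x) \<Rightarrow> 'x set \<Rightarrow> enat" where
  "cover_number G \<B> X \<rho> A =
     Inf {enat k | k. \<exists>U :: nat \<Rightarrow> 'x set.
       (\<forall>i<k. openin X (U i) \<and> G_invariant G \<rho> (U i) \<and>
              (\<exists>(Y, \<sigma>)\<in>\<B>. G_homeomorphic G (subtopology X (U i)) \<rho> Y \<sigma>)) \<and>
       A \<subseteq> (\<Union>i<k. U i)}"

definition enat_sum :: "('i \<Rightarrow> enat) \<Rightarrow> 'i set \<Rightarrow> enat" where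
  "enat_sum u I =
     (if (\<exists>i\<in>I. u i = \<infinity>) \<or> infinite {i\<in>I. u i \<noteq> 0} then \<infinity>
      else (\<Sum>i\<in>{i\<in>I. u i \<noteq> 0}. u i))"


section \<open>Flows\<close>

text \<open>Only the values \<open>\<Phi> t x\<close> with \<open>t \<ge> 0\<close> and x in X are meaningful.\<close>

definition G_semiflow ::
    "('g, 'm) monoid_scheme \<Rightarrow> 'x topology \<Rightarrow> ('g \<Rightarrow> 'x \<Rightarrow> 'x) \<Rightarrow> (real \<Rightarrow> 'x \<Rightarrow> 'x) \<Rightarrow> bool" where
  "G_semiflow G X \<rho> \<Phi> \<longleftrightarrow>
     (\<forall>t\<ge>0. G_map G X \<rho> X \<rho> (\<Phi> t)) \<and>
     (\<forall>x\<in>topspace X. \<Phi> 0 x = x) \<and>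
     (\<forall>s\<ge>0. \<forall>t\<ge>0. \<forall>x\<in>topspace X. \<Phi> s (\<Phi> t x) = \<Phi> (s + t) x) \<and>
     continuous_map (prod_topology X (top_of_set {0..})) X (\<lambda>(x, t). \<Phi> t x)"

definition G_flow ::
    "('g, 'm) monoid_scheme \<Rightarrow> 'x topology \<Rightarrow> ('g \<Rightarrow> 'x \<Rightarrow> 'x) \<Rightarrow> (real \<Rightarrow> 'x \<Rightarrow> 'x) \<Rightarrow> bool" where
  "G_flow G X \<rho> \<Phi> \<longleftrightarrow> G_semiflow G X \<rho> \<Phi> \<and> (\<forall>t\<ge>0. homeomorphic_map X X (\<Phi> t))"

definition rest_points :: "'x topology \<Rightarrow> (real \<Rightarrow> 'x \<Rightarrow> 'x) \<Rightarrow> 'x set" where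
  "rest_points X \<Phi> = {x \<in> topspace X. \<forall>t\<ge>0. \<Phi> t x = x}"

definition Lyapunov_function ::
    "('g, 'm) monoid_scheme \<Rightarrow> 'x topology \<Rightarrow> ('g \<Rightarrow> 'x \<Rightarrow> 'x) \<Rightarrow> (real \<Rightarrow> 'x \<Rightarrow> 'x) \<Rightarrow>
     ('x \<Rightarrow> real) \<Rightarrow> bool" where
  "Lyapunov_function G X \<rho> \<Phi> f \<longleftrightarrow>
     continuous_map X euclideanreal f \<and>
     (\<forall>g\<in>carrier G. \<forall>x\<in>topspace X. f (\<rho> g x) = f x) \<and>
     (\<forall>x \<in> topspace X - rest_points X \<Phi>. \<forall>s\<ge>0. \<forall>t>s. f (\<Phi> t x) < f (\<Phi> s x))"

definition gradient_like ::
    "('g, 'm) monoid_scheme \<Rightarrow> 'x topology \<Rightarrow> ('g \<Rightarrow> 'x \<Rightarrow> 'x) \<Rightarrow> (real \<Rightarrow> 'x \<Rightarrow> 'x) \<Rightarrow> bool" where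
  "gradient_like G X \<rho> \<Phi> \<longleftrightarrow> (\<exists>f. Lyapunov_function G X \<rho> \<Phi> f)"

definition condition_D ::
    "'x topology \<Rightarrow> ('x \<Rightarrow> real) \<Rightarrow> ('x \<Rightarrow> 'x) \<Rightarrow> 'x set \<Rightarrow> bool" where
  "condition_D X f \<phi> Y \<longleftrightarrow>
     (\<forall>x\<in>topspace X. \<phi> x \<noteq> x \<longrightarrow> f (\<phi> x) < f x) \<and>
     (\<forall>A\<subseteq>Y. bounded (f ` A) \<and> \<not> (\<exists>\<epsilon>>0. \<forall>y\<in>A. \<epsilon> \<le> \<bar>f y - f (\<phi> y)\<bar>) \<longrightarrow>
        (\<exists>x \<in> X closure_of A. \<phi> x = x))"

definition sublevel :: "'x topology \<Rightarrow> ('x \<Rightarrow> real) \<Rightarrow> real \<Rightarrow> 'x set" where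
  "sublevel X f a = {x \<in> topspace X. f x \<le> a}"

end

theory Submission
  imports Defs
begin

text \<open>
  The proof is the Lusternik--Schnirelmann argument for the single homeomorphism
  \<open>\<phi> = \<Phi> \<tau>\<close>. The Lyapunov function drops strictly along \<open>\<phi>\<close> off the rest points, so the
  fixed points of \<open>\<phi>\<close> are exactly the rest points, and time can be forgotten.

  The cover number \<open>\<nu>\<close> behaves like a category: it is monotone and subadditive, every set with
  finite \<open>\<nu>\<close> has an open neighbourhood with the same value of \<open>\<nu>\<close> (the union of an optimal cover), and
  \<open>\<nu> (\<phi>\<^sup>-\<^sup>1 A) \<le> \<nu> A\<close>, because the members of a cover can be pulled back along a
  G-homeomorphism (\<open>cover_number_vimage_le\<close>). The last property is where a flow, as opposed to a
  semiflow, is used.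

  Condition (D) turns into a uniform statement: on a closed strip \<open>f\<^sup>-\<^sup>1[l,r]\<close> minus an open set
  containing all fixed points of the strip, \<open>f\<close> drops under \<open>\<phi>\<close> by at least a fixed \<open>\<delta> > 0\<close>
  (\<open>uniform_drop\<close>). If there are only finitely many critical levels, this controls the growth of
  \<open>c \<mapsto> \<nu> (f\<^sup>c)\<close> from both sides of a level \<open>c\<close>: approaching \<open>c\<close> from below
  costs at most \<open>\<nu>\<close> of the critical set at level \<open>c\<close> (\<open>sublevel_cover_step_left\<close>), and
  leaving \<open>c\<close> upwards costs nothing, whether or not \<open>c\<close> is critical
  (\<open>sublevel_cover_step_right\<close>). A supremum argument on \<open>[a,b]\<close> adds these costs up. If the sum
  in question is infinite there is nothing to prove; if it is finite, then only finitely many levels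
  are critical, since \<open>\<nu>\<close> vanishes only on the empty set.
\<close>

section \<open>Cover numbers\<close>

lemma cover_number_leI:
  fixes U :: "nat \<Rightarrow> 'x set"
  assumes "\<And>i. i < k \<Longrightarrow> openin X (U i) \<and> G_invariant G \<rho> (U i) \<and>
             (\<exists>(Y, \<sigma>)\<in>\<B>. G_homeomorphic G (subtopology X (U i)) \<rho> Y \<sigma>)"
    and "A \<subseteq> (\<Union>i<k. U i)"
  shows "cover_number G \<B> X \<rho> A \<le> enat k"
  unfolding cover_number_def by (rule Inf_lower) (use assms in blast)

lemma cover_number_attained:
  assumes "cover_number G \<B> X \<rho> A = enat k"
  obtains U :: "nat \<Rightarrow> 'x set" where
    "\<And>i. i < k \<Longrightarrow> openin X (U i) \<and> G_invariant G \<rho> (U i) \<and>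
       (\<exists>(Y, \<sigma>)\<in>\<B>. G_homeomorphic G (subtopology X (U i)) \<rho> Y \<sigma>)"
    "A \<subseteq> (\<Union>i<k. U i)"
proof -
  let ?K = "{enat k | k. \<exists>U :: nat \<Rightarrow> 'x set.
       (\<forall>i<k. openin X (U i) \<and> G_invariant G \<rho> (U i) \<and>
              (\<exists>(Y, \<sigma>)\<in>\<B>. G_homeomorphic G (subtopology X (U i)) \<rho> Y \<sigma>)) \<and>
       A \<subseteq> (\<Union>i<k. U i)}"
  have "Inf ?K = enat k"
    using assms by (simp only: cover_number_def)
  moreover from this have "?K \<noteq> {}"
    by (metis Inf_empty enat.distinct(1) top_enat_def)
  ultimately have "enat k \<in> ?K"
    by (metis (no_types, lifting) equals0I wellorder_InfI)
  then obtain U :: "nat \<Rightarrow> 'x set" where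
    "\<forall>i<k. openin X (U i) \<and> G_invariant G \<rho> (U i) \<and>
       (\<exists>(Y, \<sigma>)\<in>\<B>. G_homeomorphic G (subtopology X (U i)) \<rho> Y \<sigma>)"
    "A \<subseteq> (\<Union>i<k. U i)"
    by blast
  then show thesis
    by (intro that) blast+
qed

lemma cover_number_mono:
  assumes "A \<subseteq> A'"
  shows "cover_number G \<B> X \<rho> A \<le> cover_number G \<B> X \<rho> A'"
proof (cases "cover_number G \<B> X \<rho> A'")
  case (enat k)
  obtain U where U: "\<And>i. i < k \<Longrightarrow> openin X (U i) \<and> G_invariant G \<rho> (U i) \<and>
      (\<exists>(Y, \<sigma>)\<in>\<B>. G_homeomorphic G (subtopology X (U i)) \<rho> Y \<sigma>)" "A' \<subseteq> (\<Union>i<k. U i)"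
    using cover_number_attained[OF enat] by blast
  show ?thesis
    unfolding enat by (rule cover_number_leI[where U = U]) (use U assms in blast)+
qed simp

lemma cover_number_eq_0_iff: "cover_number G \<B> X \<rho> A = 0 \<longleftrightarrow> A = {}"
proof
  assume "cover_number G \<B> X \<rho> A = 0"
  then have "cover_number G \<B> X \<rho> A = enat 0"
    by (simp add: zero_enat_def)
  then show "A = {}"
    by (rule cover_number_attained) simp
next
  assume "A = {}"
  then have "cover_number G \<B> X \<rho> A \<le> enat 0"
    by (intro cover_number_leI) auto
  then show "cover_number G \<B> X \<rho> A = 0"
    by (simp flip: zero_enat_def)
qed

lemma cover_number_Un_le:
  "cover_number G \<B> X \<rho> (A \<union> A') \<le> cover_number G \<B> X \<rho> A + cover_number G \<B> X \<rho> A'"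
proof (cases "cover_number G \<B> X \<rho> A"; cases "cover_number G \<B> X \<rho> A'")
  fix k k'
  assume k: "cover_number G \<B> X \<rho> A = enat k" and k': "cover_number G \<B> X \<rho> A' = enat k'"
  obtain U where U: "\<And>i. i < k \<Longrightarrow> openin X (U i) \<and> G_invariant G \<rho> (U i) \<and>
      (\<exists>(Y, \<sigma>)\<in>\<B>. G_homeomorphic G (subtopology X (U i)) \<rho> Y \<sigma>)" "A \<subseteq> (\<Union>i<k. U i)"
    using cover_number_attained[OF k] by blast
  obtain U' where U': "\<And>i. i < k' \<Longrightarrow> openin X (U' i) \<and> G_invariant G \<rho> (U' i) \<and>
      (\<exists>(Y, \<sigma>)\<in>\<B>. G_homeomorphic G (subtopology X (U' i)) \<rho> Y \<sigma>)" "A' \<subseteq> (\<Union>i<k'. U' i)"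
    using cover_number_attained[OF k'] by blast
  define W where "W i = (if i < k then U i else U' (i - k))" for i
  have "U i \<subseteq> (\<Union>i<k + k'. W i)" if "i < k" for i
    using that by (force simp: W_def)
  moreover have "U' i \<subseteq> (\<Union>i<k + k'. W i)" if "i < k'" for i
  proof -
    have "U' i = W (k + i)" "k + i < k + k'"
      using that by (simp_all add: W_def)
    then show ?thesis
      by blast
  qed
  ultimately have "(\<Union>i<k. U i) \<union> (\<Union>i<k'. U' i) \<subseteq> (\<Union>i<k + k'. W i)"
    by (intro Un_least UN_least) simp_all
  then have "A \<union> A' \<subseteq> (\<Union>i<k + k'. W i)"
    by (rule subset_trans[OF Un_mono[OF U(2) U'(2)]])
  then have "cover_number G \<B> X \<rho> (A \<union> A') \<le> enat (k + k')"
    using U(1) U'(1) by (intro cover_number_leI[where U = W]) (auto simp: W_def)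
  then show ?thesis
    by (simp add: k k')
qed simp_all

lemma cover_number_open_nbhd:
  assumes "cover_number G \<B> X \<rho> A \<noteq> \<infinity>"
  obtains U where "openin X U" "A \<subseteq> U" "cover_number G \<B> X \<rho> U = cover_number G \<B> X \<rho> A"
proof -
  obtain k where k: "cover_number G \<B> X \<rho> A = enat k"
    using assms by blast
  obtain U where U: "\<And>i. i < k \<Longrightarrow> openin X (U i) \<and> G_invariant G \<rho> (U i) \<and>
      (\<exists>(Y, \<sigma>)\<in>\<B>. G_homeomorphic G (subtopology X (U i)) \<rho> Y \<sigma>)" "A \<subseteq> (\<Union>i<k. U i)"
    using cover_number_attained[OF k] by blast
  have "cover_number G \<B> X \<rho> (\<Union>i<k. U i) \<le> cover_number G \<B> X \<rho> A"
    unfolding k by (rule cover_number_leI[where U = U]) (use U(1) in auto)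
  then show thesis
    using U by (intro that[of "\<Union>i<k. U i"]) (auto intro!: antisym cover_number_mono)
qed

text \<open>Precomposing with \<open>\<phi>\<close> turns a G-homeomorphism from \<open>U\<close> onto a member of the class into
  one from the preimage of \<open>U\<close>, so preimages of a cover by members of the class form again such a
  cover.\<close>

lemma cover_number_vimage_le:
  assumes hom: "homeomorphic_map X X \<phi>" and equi: "G_map G X \<rho> X \<rho> \<phi>"
    and action: "G_invariant G \<rho> (topspace X)"
  shows "cover_number G \<B> X \<rho> {x \<in> topspace X. \<phi> x \<in> A} \<le> cover_number G \<B> X \<rho> A"
proof (cases "cover_number G \<B> X \<rho> A")
  case (enat k)
  obtain U where U: "\<And>i. i < k \<Longrightarrow> openin X (U i) \<and> G_invariant G \<rho> (U i) \<and>
      (\<exists>(Y, \<sigma>)\<in>\<B>. G_homeomorphic G (subtopology X (U i)) \<rho> Y \<sigma>)" "A \<subseteq> (\<Union>i<k. U i)"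
    using cover_number_attained[OF enat] by blast
  define V where "V i = {x \<in> topspace X. \<phi> x \<in> U i}" for i
  have "openin X (V i) \<and> G_invariant G \<rho> (V i) \<and>
      (\<exists>(Y, \<sigma>)\<in>\<B>. G_homeomorphic G (subtopology X (V i)) \<rho> Y \<sigma>)" if i: "i < k" for i
  proof (intro conjI)
    show "openin X (V i)"
      unfolding V_def using homeomorphic_imp_continuous_map[OF hom] U(1)[OF i]
      by (simp add: openin_continuous_map_preimage)
    show "G_invariant G \<rho> (V i)"
      using U(1)[OF i] equi action by (auto simp: V_def G_invariant_def G_map_def)
    obtain Y \<sigma> h where Y: "(Y, \<sigma>) \<in> \<B>" and h: "homeomorphic_map (subtopology X (U i)) Y h"
      "G_map G (subtopology X (U i)) \<rho> Y \<sigma> h"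
      using U(1)[OF i] unfolding G_homeomorphic_def by blast
    have "U i \<subseteq> topspace X"
      using U(1)[OF i] openin_subset by blast
    then have "\<phi> ` V i = U i"
      using homeomorphic_imp_surjective_map[OF hom] by (auto simp: V_def)
    then have "homeomorphic_map (subtopology X (V i)) (subtopology X (U i)) \<phi>"
      using \<open>U i \<subseteq> topspace X\<close> by (intro homeomorphic_map_subtopologies[OF hom]) (auto simp: V_def)
    then have comp: "homeomorphic_map (subtopology X (V i)) Y (h \<circ> \<phi>)"
      using h(1) homeomorphic_map_compose by blast
    moreover have "G_map G (subtopology X (V i)) \<rho> Y \<sigma> (h \<circ> \<phi>)"
      using h(2) equi homeomorphic_imp_continuous_map[OF comp] \<open>U i \<subseteq> topspace X\<close>
      by (auto simp: G_map_def V_def)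
    ultimately show "\<exists>(Y, \<sigma>)\<in>\<B>. G_homeomorphic G (subtopology X (V i)) \<rho> Y \<sigma>"
      using Y unfolding G_homeomorphic_def by blast
  qed
  moreover have "{x \<in> topspace X. \<phi> x \<in> A} \<subseteq> (\<Union>i<k. V i)"
    using U(2) by (auto simp: V_def)
  ultimately show ?thesis
    unfolding enat by (rule cover_number_leI)
qed simp

section \<open>Sublevel sets of a descending G-homeomorphism\<close>

locale descending_G_homeomorphism =
  fixes G :: "('g, 'm) monoid_scheme"
    and \<B> :: "('y topology \<times> ('g \<Rightarrow> 'y \<Rightarrow> 'y)) set"
    and X :: "'x topology" and \<rho> :: "'g \<Rightarrow> 'x \<Rightarrow> 'x"
    and \<phi> :: "'x \<Rightarrow> 'x" and f :: "'x \<Rightarrow> real" and a b :: real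
  assumes action: "G_invariant G \<rho> (topspace X)"
    and hom: "homeomorphic_map X X \<phi>"
    and equi: "G_map G X \<rho> X \<rho> \<phi>"
    and cont: "continuous_map X euclideanreal f"
    and condD: "condition_D X f \<phi> {x \<in> topspace X. f x \<in> {a..b}}"
begin

abbreviation \<nu> :: "'x set \<Rightarrow> enat" where
  "\<nu> \<equiv> cover_number G \<B> X \<rho>"

definition crit :: "real \<Rightarrow> 'x set" where
  "crit d = {x \<in> topspace X. \<phi> x = x \<and> f x = d}"

lemma phi_in_topspace: "x \<in> topspace X \<Longrightarrow> \<phi> x \<in> topspace X"
  using homeomorphic_imp_surjective_map[OF hom] by blast

lemma f_phi_le: "x \<in> topspace X \<Longrightarrow> f (\<phi> x) \<le> f x"
  using condD unfolding condition_D_def by (cases "\<phi> x = x") (auto intro: less_imp_le)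

lemma \<nu>_le_of_phi:
  assumes "\<And>x. x \<in> A \<Longrightarrow> x \<in> topspace X \<and> \<phi> x \<in> A'"
  shows "\<nu> A \<le> \<nu> A'"
proof -
  have "\<nu> A \<le> \<nu> {x \<in> topspace X. \<phi> x \<in> A'}"
    using assms by (intro cover_number_mono) auto
  also have "\<dots> \<le> \<nu> A'"
    by (rule cover_number_vimage_le[OF hom equi action])
  finally show ?thesis .
qed

text \<open>The strip minus \<open>V\<close> is closed, so a point in its closure that condition (D) would produce
  from arbitrarily small drops would be a fixed point in the strip outside \<open>V\<close>, and there is
  none.\<close>

lemma uniform_drop:
  assumes "openin X V" "a \<le> l" "r \<le> b"
    and crit: "\<And>d. d \<in> {l..r} \<Longrightarrow> crit d \<subseteq> V"
  obtains \<delta> where "\<delta> > 0"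
    "\<And>x. \<lbrakk>x \<in> topspace X; l \<le> f x; f x \<le> r; x \<notin> V\<rbrakk> \<Longrightarrow> f (\<phi> x) \<le> f x - \<delta>"
proof -
  define A where "A = {x \<in> topspace X. f x \<in> {l..r}} - V"
  have "closedin X {x \<in> topspace X. f x \<in> {l..r}}"
    by (rule closedin_continuous_map_preimage[OF cont]) simp
  then have "X closure_of A = A"
    using \<open>openin X V\<close> by (simp add: A_def closure_of_closedin closedin_diff)
  moreover have "\<phi> x \<noteq> x" if "x \<in> A" for x
    using crit[of "f x"] that by (auto simp: A_def crit_def)
  moreover have "bounded (f ` A)"
    by (rule bounded_subset[of "{l..r}"]) (auto simp: A_def)
  moreover have "A \<subseteq> {x \<in> topspace X. f x \<in> {a..b}}"
    using assms by (auto simp: A_def)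
  ultimately obtain \<delta> where "\<delta> > 0" and \<delta>: "\<forall>y\<in>A. \<delta> \<le> \<bar>f y - f (\<phi> y)\<bar>"
    using condD unfolding condition_D_def by metis
  moreover have "f (\<phi> x) \<le> f x - \<delta>"
    if "x \<in> topspace X" "l \<le> f x" "f x \<le> r" "x \<notin> V" for x
    using that bspec[OF \<delta>, of x] f_phi_le[of x] by (auto simp: A_def)
  ultimately show thesis
    by (intro that)
qed

text \<open>A point at level at most \<open>c\<close> either lies in an optimal neighbourhood of the critical set
  at level \<open>c\<close>, or it is pushed below \<open>c\<close> by a fixed amount.\<close>

lemma sublevel_cover_step_left:
  assumes "a < c" "c \<le> b" and fin: "finite {d \<in> {a<..b}. crit d \<noteq> {}}"
  obtains \<epsilon> where "\<epsilon> > 0"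
    "\<And>c'. c - \<epsilon> \<le> c' \<Longrightarrow> \<nu> (sublevel X f c) \<le> \<nu> (sublevel X f c') + \<nu> (crit c)"
proof (cases "\<nu> (crit c) = \<infinity>")
  case True
  then show thesis
    by (intro that[of 1]) auto
next
  case False
  then obtain U where U: "openin X U" "crit c \<subseteq> U" "\<nu> U = \<nu> (crit c)"
    by (rule cover_number_open_nbhd)
  \<comment> \<open>By finiteness there is a level \<open>l < c\<close> with no critical level in \<open>[l, c)\<close>.\<close>
  define D where "D = {d \<in> {a<..b}. crit d \<noteq> {}} \<inter> {..<c}"
  define l where "l = (Max (insert a D) + c) / 2"
  have "finite D"
    using fin by (simp add: D_def)
  have M: "a \<le> Max (insert a D)" "Max (insert a D) < c"
    using \<open>finite D\<close> \<open>a < c\<close> by (auto simp: D_def)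
  then have l: "a \<le> l" "a < l" "l < c"
    by (auto simp: l_def)
  have "crit d \<subseteq> U" if "d \<in> {l..c}" for d
  proof (cases "d = c")
    case False
    have "d \<notin> D"
    proof
      assume "d \<in> D"
      then have "d \<le> Max (insert a D)"
        using \<open>finite D\<close> by (intro Max_ge) auto
      then show False
        using that M by (simp add: l_def)
    qed
    then show ?thesis
      using that l False \<open>c \<le> b\<close> by (auto simp: D_def)
  qed (use U in simp)
  then obtain \<delta> where "\<delta> > 0" and \<delta>:
    "\<And>x. \<lbrakk>x \<in> topspace X; l \<le> f x; f x \<le> c; x \<notin> U\<rbrakk> \<Longrightarrow> f (\<phi> x) \<le> f x - \<delta>"
    using uniform_drop[of U l c] U(1) l(1) \<open>c \<le> b\<close> by blast
  have "\<nu> (sublevel X f c) \<le> \<nu> (sublevel X f c') + \<nu> (crit c)" if "c - min \<delta> (c - l) \<le> c'" for c'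
  proof -
    have "\<phi> x \<in> sublevel X f c'" if "x \<in> sublevel X f c - U" for x
      using that \<delta>[of x] f_phi_le[of x] phi_in_topspace[of x] \<open>c - min \<delta> (c - l) \<le> c'\<close>
      by (cases "l \<le> f x") (auto simp: sublevel_def)
    then have low: "\<nu> (sublevel X f c - U) \<le> \<nu> (sublevel X f c')"
      by (intro \<nu>_le_of_phi) (auto simp: sublevel_def)
    have "\<nu> (sublevel X f c) \<le> \<nu> ((sublevel X f c - U) \<union> U)"
      by (rule cover_number_mono) blast
    also have "\<dots> \<le> \<nu> (sublevel X f c - U) + \<nu> U"
      by (rule cover_number_Un_le)
    also have "\<dots> \<le> \<nu> (sublevel X f c') + \<nu> (crit c)"
      unfolding U(3) using low by (rule add_right_mono)
    finally show ?thesis .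
  qed
  then show thesis
    using l \<open>\<delta> > 0\<close> by (intro that[of "min \<delta> (c - l)"]) auto
qed

text \<open>Here critical points at level \<open>c\<close> must not be counted again. With \<open>U\<close> an optimal
  neighbourhood of the whole sublevel set, \<open>\<phi>\<close> moves all of a slightly higher sublevel set into
  \<open>U\<close>: points of \<open>V = U \<inter> \<phi>\<^sup>-\<^sup>1 U\<close> by definition, the others because they drop
  below \<open>c\<close>.\<close>

lemma sublevel_cover_step_right:
  assumes "a \<le> c" "c < b" and fin: "finite {d \<in> {a<..b}. crit d \<noteq> {}}"
  obtains c' where "c < c'" "c' \<le> b" "\<nu> (sublevel X f c') \<le> \<nu> (sublevel X f c)"
proof (cases "\<nu> (sublevel X f c) = \<infinity>")
  case True
  then show thesis
    using \<open>c < b\<close> by (intro that[of b]) auto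
next
  case False
  then obtain U where U: "openin X U" "sublevel X f c \<subseteq> U" "\<nu> U = \<nu> (sublevel X f c)"
    by (rule cover_number_open_nbhd)
  define V where "V = U \<inter> {x \<in> topspace X. \<phi> x \<in> U}"
  have "openin X V"
    unfolding V_def using U(1) homeomorphic_imp_continuous_map[OF hom]
    by (intro openin_Int openin_continuous_map_preimage)
  have low: "sublevel X f c \<subseteq> V"
    using U(2) phi_in_topspace f_phi_le by (force simp: V_def sublevel_def)
  \<comment> \<open>By finiteness there is a level \<open>r > c\<close> with no critical level in \<open>(c, r]\<close>.\<close>
  define D where "D = {d \<in> {a<..b}. crit d \<noteq> {}} \<inter> {c<..}"
  define r where "r = (c + Min (insert b D)) / 2"
  have "finite D"
    using fin by (simp add: D_def)
  have M: "Min (insert b D) \<le> b" "c < Min (insert b D)"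
    using \<open>finite D\<close> \<open>c < b\<close> by (auto simp: D_def)
  then have r: "c < r" "r \<le> b"
    using \<open>c < b\<close> by (auto simp: r_def)
  have "crit d \<subseteq> V" if "d \<in> {c..r}" for d
  proof (cases "d = c")
    case True
    then show ?thesis
      using low by (auto simp: crit_def sublevel_def)
  next
    case False
    have "d \<notin> D"
    proof
      assume "d \<in> D"
      then have "Min (insert b D) \<le> d"
        using \<open>finite D\<close> by (intro Min_le) auto
      then show False
        using that M by (simp add: r_def)
    qed
    then show ?thesis
      using that r False \<open>a \<le> c\<close> by (auto simp: D_def)
  qed
  then obtain \<delta> where "\<delta> > 0" and \<delta>:
    "\<And>x. \<lbrakk>x \<in> topspace X; c \<le> f x; f x \<le> r; x \<notin> V\<rbrakk> \<Longrightarrow> f (\<phi> x) \<le> f x - \<delta>"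
    using uniform_drop[of V c r] \<open>openin X V\<close> \<open>a \<le> c\<close> r by blast
  define c' where "c' = min r (c + \<delta>)"
  have c': "c < c'" "c' \<le> b"
    using r \<open>\<delta> > 0\<close> by (auto simp: c'_def)
  have "\<phi> x \<in> U" if x: "x \<in> sublevel X f c'" for x
  proof (cases "x \<in> V")
    case True
    then show ?thesis
      by (simp add: V_def)
  next
    case False
    then have "c < f x"
      using low x by (force simp: sublevel_def)
    then have "f (\<phi> x) \<le> f x - \<delta>"
      using \<delta>[of x] x False by (simp add: sublevel_def c'_def)
    then have "\<phi> x \<in> sublevel X f c"
      using x phi_in_topspace[of x] by (auto simp: sublevel_def c'_def)
    then show ?thesis
      using U(2) by blast
  qed
  then have "\<nu> (sublevel X f c') \<le> \<nu> U"
    by (intro \<nu>_le_of_phi) (auto simp: sublevel_def)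
  then show thesis
    using c' U(3) by (intro that[of c']) auto
qed

theorem sublevel_cover_le:
  assumes "a < b" and fin: "finite {d \<in> {a<..b}. crit d \<noteq> {}}"
  shows "\<nu> (sublevel X f b) \<le>
    \<nu> (sublevel X f a) + (\<Sum>d\<in>{d \<in> {a<..b}. crit d \<noteq> {}}. \<nu> (crit d))"
proof -
  define C where "C = {d \<in> {a<..b}. crit d \<noteq> {}}"
  have "finite C"
    using fin by (simp add: C_def)
  define B where "B c = \<nu> (sublevel X f a) + (\<Sum>d\<in>C \<inter> {..c}. \<nu> (crit d))" for c
  have B_mono: "B c \<le> B c'" if "c \<le> c'" for c c'
    unfolding B_def using that \<open>finite C\<close>
    by (intro add_left_mono sum_mono2) auto
  define S where "S = {c \<in> {a..b}. \<nu> (sublevel X f c) \<le> B c}"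
  have "a \<in> S"
    using \<open>a < b\<close> by (simp add: S_def B_def)
  have bdd: "bdd_above S"
    by (rule bdd_aboveI[of _ b]) (simp add: S_def)
  define s where "s = Sup S"
  have "a \<le> s"
    unfolding s_def using \<open>a \<in> S\<close> bdd by (rule cSup_upper)
  have "s \<le> b"
    unfolding s_def using \<open>a \<in> S\<close> by (intro cSup_least) (auto simp: S_def)
  have "s \<in> S"
  proof (cases "s = a")
    case False
    then have "a < s"
      using \<open>a \<le> s\<close> by simp
    then obtain \<epsilon> where "\<epsilon> > 0" and \<epsilon>:
      "\<And>c'. s - \<epsilon> \<le> c' \<Longrightarrow> \<nu> (sublevel X f s) \<le> \<nu> (sublevel X f c') + \<nu> (crit s)"
      using sublevel_cover_step_left[OF _ \<open>s \<le> b\<close> fin] by blast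
    obtain c where c: "c \<in> S" "s - \<epsilon> < c"
      using less_cSup_iff[of S "s - \<epsilon>"] \<open>a \<in> S\<close> bdd \<open>\<epsilon> > 0\<close> by (auto simp: s_def)
    show ?thesis
    proof (cases "c = s")
      case False
      have "c < s"
        using cSup_upper[OF c(1) bdd] False by (simp add: s_def)
      have step: "B c + \<nu> (crit s) \<le> B s"
      proof (cases "s \<in> C")
        case True
        have "B c + \<nu> (crit s) =
            \<nu> (sublevel X f a) + (\<Sum>d\<in>insert s (C \<inter> {..c}). \<nu> (crit d))"
          using \<open>c < s\<close> \<open>finite C\<close> by (simp add: B_def algebra_simps)
        also have "\<dots> \<le> B s"
          unfolding B_def using \<open>c < s\<close> \<open>finite C\<close> True
          by (intro add_left_mono sum_mono2) auto
        finally show ?thesis .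
      next
        case False
        then have "crit s = {}"
          using \<open>a < s\<close> \<open>s \<le> b\<close> by (simp add: C_def)
        then have "\<nu> (crit s) = 0"
          by (simp add: cover_number_eq_0_iff)
        then show ?thesis
          using B_mono[of c s] \<open>c < s\<close> by simp
      qed
      have "\<nu> (sublevel X f s) \<le> \<nu> (sublevel X f c) + \<nu> (crit s)"
        using \<epsilon> c by simp
      also have "\<dots> \<le> B c + \<nu> (crit s)"
        using c by (intro add_right_mono) (simp add: S_def)
      also note step
      finally show ?thesis
        using \<open>a \<le> s\<close> \<open>s \<le> b\<close> by (simp add: S_def)
    qed (use c in simp)
  qed (use \<open>a \<in> S\<close> in simp)
  have "s = b"
  proof (rule ccontr)
    assume "s \<noteq> b"
    then have "s < b"
      using \<open>s \<le> b\<close> by simp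
    then obtain c where c: "s < c" "c \<le> b" "\<nu> (sublevel X f c) \<le> \<nu> (sublevel X f s)"
      using sublevel_cover_step_right[OF \<open>a \<le> s\<close> _ fin] by blast
    have "\<nu> (sublevel X f c) \<le> B c"
      using c(3) \<open>s \<in> S\<close> B_mono[of s c] c(1) by (auto simp: S_def)
    then have "c \<in> S"
      using c \<open>a \<le> s\<close> by (simp add: S_def)
    then show False
      using cSup_upper[OF _ bdd, of c] c(1) by (simp add: s_def)
  qed
  moreover have "C \<inter> {..b} = C"
    by (auto simp: C_def)
  ultimately show ?thesis
    using \<open>s \<in> S\<close> unfolding C_def[symmetric] by (simp add: S_def B_def)
qed

end

section \<open>Gradient-like flows\<close>

text \<open>Unless a point rests, \<open>f\<close> drops between time \<open>0\<close> and time \<open>\<tau>\<close>.\<close>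

lemma rest_point_iff_fixed_point:
  assumes "Lyapunov_function G X \<rho> \<Phi> f" "G_flow G X \<rho> \<Phi>" "\<tau> > 0" "x \<in> topspace X"
  shows "x \<in> rest_points X \<Phi> \<longleftrightarrow> \<Phi> \<tau> x = x"
proof
  assume "x \<in> rest_points X \<Phi>"
  then show "\<Phi> \<tau> x = x"
    using \<open>\<tau> > 0\<close> by (simp add: rest_points_def)
next
  assume "\<Phi> \<tau> x = x"
  moreover have "\<Phi> 0 x = x"
    using assms by (simp add: G_flow_def G_semiflow_def)
  moreover have "f (\<Phi> \<tau> x) < f (\<Phi> 0 x)" if "x \<notin> rest_points X \<Phi>"
    using assms that by (simp add: Lyapunov_function_def)
  ultimately show "x \<in> rest_points X \<Phi>"
    by auto
qed


theorem corollary8p4: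
  fixes G :: "('g, 'm) monoid_scheme" and T :: "'g topology"
    and \<B> :: "('y topology \<times> ('g \<Rightarrow> 'y \<Rightarrow> 'y)) set"
    and X :: "'x topology" and \<rho> :: "'g \<Rightarrow> 'x \<Rightarrow> 'x"
    and \<Phi> :: "real \<Rightarrow> 'x \<Rightarrow> 'x" and R :: "'x set"
    and f :: "'x \<Rightarrow> real" and a b :: real
  assumes "compact_Lie_group G T"
    and "\<forall>(Y, \<sigma>)\<in>\<B>. G_space G T Y \<sigma>"
    and "G_space G T X \<rho>"
    and "G_flow G X \<rho> \<Phi>"
    and "gradient_like G X \<rho> \<Phi>"
    and "R = rest_points X \<Phi>"
    and "a < b"
    and "Lyapunov_function G X \<rho> \<Phi> f"
    and "\<exists>\<tau>>0. condition_D X f (\<Phi> \<tau>) {x \<in> topspace X. f x \<in> {a..b}}"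
    and "cover_number G \<B> X \<rho> (sublevel X f a) \<noteq> \<infinity>"
  shows "ereal_of_enat
           (enat_sum (\<lambda>d. cover_number G \<B> X \<rho> (R \<inter> {x \<in> topspace X. f x = d})) {a<..b})
         \<ge> ereal_of_enat (cover_number G \<B> X \<rho> (sublevel X f b))
             - ereal_of_enat (cover_number G \<B> X \<rho> (sublevel X f a))"
proof -
  obtain \<tau> where "\<tau> > 0" and D: "condition_D X f (\<Phi> \<tau>) {x \<in> topspace X. f x \<in> {a..b}}"
    using assms by blast
  interpret descending_G_homeomorphism G \<B> X \<rho> "\<Phi> \<tau>" f a b
  proof
    show "G_invariant G \<rho> (topspace X)"
      using assms(3) group_action.element_image[of G "topspace X" \<rho>]
      unfolding G_space_def G_invariant_def by blast
  qed (use assms \<open>\<tau> > 0\<close> D in \<open>auto simp: G_flow_def G_semiflow_def Lyapunov_function_def\<close>)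
  have crit: "R \<inter> {x \<in> topspace X. f x = d} = crit d" for d
    using rest_point_iff_fixed_point[OF assms(8,4) \<open>\<tau> > 0\<close>] assms(6) by (auto simp: crit_def)
  have "\<nu> (sublevel X f b) \<le> \<nu> (sublevel X f a) + enat_sum (\<lambda>d. \<nu> (crit d)) {a<..b}"
  proof (cases "(\<exists>d\<in>{a<..b}. \<nu> (crit d) = \<infinity>) \<or> infinite {d \<in> {a<..b}. crit d \<noteq> {}}")
    case True
    then have "enat_sum (\<lambda>d. \<nu> (crit d)) {a<..b} = \<infinity>"
      by (simp add: enat_sum_def cover_number_eq_0_iff)
    then show ?thesis
      by simp
  next
    case False
    then have "enat_sum (\<lambda>d. \<nu> (crit d)) {a<..b} = (\<Sum>d\<in>{d \<in> {a<..b}. crit d \<noteq> {}}. \<nu> (crit d))"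
      unfolding enat_sum_def cover_number_eq_0_iff by (rule if_not_P)
    then show ?thesis
      using sublevel_cover_le[OF assms(7)] False by simp
  qed
  then have "ereal_of_enat (\<nu> (sublevel X f b)) \<le>
      ereal_of_enat (enat_sum (\<lambda>d. \<nu> (crit d)) {a<..b}) + ereal_of_enat (\<nu> (sublevel X f a))"
    by (metis add.commute ereal_of_enat_add ereal_of_enat_le_iff)
  then show ?thesis
    unfolding crit using assms(10) by (subst ereal_minus_le) auto
qed

end
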